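(* Let $\varphi(x)$ be an $\mathcal{L}_{rings}$-formula in one free variable, and let $R$ be a commutative unital ring satisfying the axioms $\mathcal{A}_{\varphi}$ (described in the context) with distinguished ideal $\mathcal{F}in\subseteq\mathbb{B}$. Suppose $R$ satisfies condition $(\sharp)$: for every $e\in\mathcal{F}in$ there are $g,h\in R$ with $$[[e=1]]\leq [[gh=1 \wedge \varphi(g) \wedge \neg \varphi(h)]].$$ Then $\mathcal{F}in$ is definable: for every idempotent $e$ of $R$, $$e\in \mathcal{F}in \iff \exists g \,\exists h\ \big(e\leq [[gh=1 \wedge \varphi(g) \wedge \neg \varphi(h)]]\big).$$
   Context: All rings are commutative and unital with $0\neq 1$; $\mathcal{L}_{rings}=\{+,\cdot,0,1\}$. For a ring $R$, $\mathbb{B}$ is the Boolean algebra of idempotents with $e\wedge f=ef$, $\neg e=1-e$, $e\vee f=e+f-ef$, $0$, $1$, order $e\le f\iff ef=e$. An atom is a minimal nonzero element of $\mathbb{B}$. For an idempotent $e$, $R_e$ is the localization of $R$ at $\{e^n:n\ge0\}$ (isomorphic to $R/(1-e)R$), and $(f)_e$ the image of $f\in R$ in $R_e$. For an $\mathcal{L}_{rings}$-formula $\Theta(x_1,\dots,x_n)$ and $f_i\in R$, $[[\Theta(f_1,\dots,f_n)]]$ is the supremum in $\mathbb{B}$ of the atoms $e$ with $R_e\models\Theta((f_1)_e,\dots,(f_n)_e)$, when it exists. $T^{fin}$ is the theory, in the language $\{\vee,\wedge,\neg,0,1,Fin\}$ with $Fin$ a unary predicate, stating: the Boolean algebra is infinite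 and atomic; $Fin$ is a proper ideal; $\forall x(\neg Fin(x)\to\exists y(y<x\wedge\neg Fin(y)\wedge\neg Fin(x\wedge\neg y)))$; and for each $n<\omega$, every element with at most $n$ atoms below it lies in $Fin$. The axiom set $\mathcal{A}_\varphi$ consists of: (1) $\mathbb{B}$ is atomic; (2) $[[\Theta(f_1,\dots,f_n)]]$ exists in $\mathbb{B}$ for every $\mathcal{L}_{rings}$-formula $\Theta$ and all $f_i\in R$; (3) for every atomic $\mathcal{L}_{rings}$-formula $\Theta$, $R\models\Theta(f_1,\dots,f_n)$ iff $[[\Theta(f_1,\dots,f_n)]]=1$; ($4^{fin}$) $R$ is equipped with an ideal $\mathcal{F}in$ of $\mathbb{B}$ such that $(\mathbb{B},\mathcal{F}in)\models T^{fin}$, and for every $\mathcal{L}_{rings}$-formula $\Theta(x_1,\dots,x_n,w)$ and $f_1,\dots,f_n\in R$ there is $g\in R$ such that if $[[\exists w\,\Theta(\bar f,w)]]\wedge\neg[[\exists w\,(\varphi(w)\wedge\Theta(\bar f,w))]]\in\mathcal{F}in$ then $[[\exists w\,\Theta(\bar f,w)]]\wedge\neg[[\Theta(\bar f,g)]]\in\mathcal{F}in$; (5) for all $x\in R$, $[[\neg\varphi(x)]]\in\mathcal{F}in$. *)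

theory Defs
  imports "HOL-Algebra.Ring" "HOL-Algebra.Lattice"
begin

section \<open>First-order formulas in the language of rings\<close>

text \<open>De Bruijn indices: \<open>Ex\<close> binds index 0 and shifts the others up by one.
  A formula \<open>\<Theta>(x\<^sub>1,\<dots>,x\<^sub>n)\<close> is one with \<open>fvf \<Theta> \<subseteq> {..<n}\<close>, and \<open>\<Theta>(f\<^sub>1,\<dots>,f\<^sub>n)\<close> is interpreted by the
  list \<open>[f\<^sub>1,\<dots>,f\<^sub>n]\<close>, index \<open>i\<close> denoting its entry number \<open>i\<close> (counted from 0).  The
  omitted connectives and the universal quantifier are definable.\<close>

datatype rterm = Var nat | Zero | One | Add rterm rterm | Mul rterm rterm

datatype rform = Eq rterm rterm | Neg rform | Conj rform rform | Ex rform

primrec fvt :: "rterm \<Rightarrow> nat set" where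
  "fvt (Var i) = {i}"
| "fvt Zero = {}"
| "fvt One = {}"
| "fvt (Add s t) = fvt s \<union> fvt t"
| "fvt (Mul s t) = fvt s \<union> fvt t"

primrec fvf :: "rform \<Rightarrow> nat set" where
  "fvf (Eq s t) = fvt s \<union> fvt t"
| "fvf (Neg \<phi>) = fvf \<phi>"
| "fvf (Conj \<phi> \<psi>) = fvf \<phi> \<union> fvf \<psi>"
| "fvf (Ex \<phi>) = {i. Suc i \<in> fvf \<phi>}"

primrec tval :: "('a, 'm) ring_scheme \<Rightarrow> 'a list \<Rightarrow> rterm \<Rightarrow> 'a" where
  "tval R xs (Var i) = xs ! i"
| "tval R xs Zero = \<zero>\<^bsub>R\<^esub>"
| "tval R xs One = \<one>\<^bsub>R\<^esub>"
| "tval R xs (Add s t) = tval R xs s \<oplus>\<^bsub>R\<^esub> tval R xs t"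
| "tval R xs (Mul s t) = tval R xs s \<otimes>\<^bsub>R\<^esub> tval R xs t"

primrec sat :: "('a, 'm) ring_scheme \<Rightarrow> 'a list \<Rightarrow> rform \<Rightarrow> bool" where
  "sat R xs (Eq s t) \<longleftrightarrow> tval R xs s = tval R xs t"
| "sat R xs (Neg \<phi>) \<longleftrightarrow> \<not> sat R xs \<phi>"
| "sat R xs (Conj \<phi> \<psi>) \<longleftrightarrow> sat R xs \<phi> \<and> sat R xs \<psi>"
| "sat R xs (Ex \<phi>) \<longleftrightarrow> (\<exists>a\<in>carrier R. sat R (a # xs) \<phi>)"

primrec rent :: "(nat \<Rightarrow> nat) \<Rightarrow> rterm \<Rightarrow> rterm" where
  "rent r (Var i) = Var (r i)"
| "rent r Zero = Zero"
| "rent r One = One"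
| "rent r (Add s t) = Add (rent r s) (rent r t)"
| "rent r (Mul s t) = Mul (rent r s) (rent r t)"

primrec renf :: "(nat \<Rightarrow> nat) \<Rightarrow> rform \<Rightarrow> rform" where
  "renf r (Eq s t) = Eq (rent r s) (rent r t)"
| "renf r (Neg \<phi>) = Neg (renf r \<phi>)"
| "renf r (Conj \<phi> \<psi>) = Conj (renf r \<phi>) (renf r \<psi>)"
| "renf r (Ex \<phi>) = Ex (renf (case_nat 0 (Suc \<circ> r)) \<phi>)"

lemma tval_rent:
  assumes "\<And>i. i \<in> fvt t \<Longrightarrow> ys ! r i = xs ! i"
  shows "tval R ys (rent r t) = tval R xs t"
  using assms by (induction t) auto

lemma sat_renf:
  assumes "\<And>i. i \<in> fvf \<phi> \<Longrightarrow> ys ! r i = xs ! i"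
  shows "sat R ys (renf r \<phi>) \<longleftrightarrow> sat R xs \<phi>"
  using assms
proof (induction \<phi> arbitrary: r xs ys)
  case (Eq s t)
  then show ?case by (simp add: tval_rent[where xs = xs])
next
  case (Conj \<phi> \<psi>)
  then show ?case by (metis UnCI fvf.simps(3) renf.simps(3) sat.simps(3))
next
  case (Neg \<phi>)
  then show ?case by (metis fvf.simps(2) renf.simps(2) sat.simps(2))
next
  case (Ex \<phi>)
  have "sat R (a # ys) (renf (case_nat 0 (Suc \<circ> r)) \<phi>) \<longleftrightarrow> sat R (a # xs) \<phi>" for a
  proof (rule Ex.IH)
    fix i assume "i \<in> fvf \<phi>"
    then show "(a # ys) ! case_nat 0 (Suc \<circ> r) i = (a # xs) ! i"
      using Ex.prems by (cases i) auto
  qed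
  then show ?case by simp
qed

text \<open>Definability is in the language of rings, without parameters.\<close>

definition definable :: "('a, 'm) ring_scheme \<Rightarrow> 'a set \<Rightarrow> bool" where
  "definable R X \<longleftrightarrow> (\<exists>\<psi>. fvf \<psi> \<subseteq> {..<1} \<and> X = {x \<in> carrier R. sat R [x] \<psi>})"


section \<open>Localization\<close>

definition frac_rel ::
    "('a, 'm) ring_scheme \<Rightarrow> 'a set \<Rightarrow> (('a \<times> 'a) \<times> ('a \<times> 'a)) set" where
  "frac_rel R S = {((a, s), (b, t)). a \<in> carrier R \<and> b \<in> carrier R \<and> s \<in> S \<and> t \<in> S \<and>
     (\<exists>u\<in>S. u \<otimes>\<^bsub>R\<^esub> (a \<otimes>\<^bsub>R\<^esub> t \<ominus>\<^bsub>R\<^esub> b \<otimes>\<^bsub>R\<^esub> s) = \<zero>\<^bsub>R\<^esub>)}"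

definition frac :: "('a, 'm) ring_scheme \<Rightarrow> 'a set \<Rightarrow> 'a \<Rightarrow> 'a \<Rightarrow> ('a \<times> 'a) set" where
  "frac R S a s = frac_rel R S `` {(a, s)}"

definition localization :: "('a, 'm) ring_scheme \<Rightarrow> 'a set \<Rightarrow> ('a \<times> 'a) set ring" where
  "localization R S =
     \<lparr> carrier = (carrier R \<times> S) // frac_rel R S,
       mult = (\<lambda>X Y. \<Union>(a, s)\<in>X. \<Union>(b, t)\<in>Y. frac R S (a \<otimes>\<^bsub>R\<^esub> b) (s \<otimes>\<^bsub>R\<^esub> t)),
       one = frac R S \<one>\<^bsub>R\<^esub> \<one>\<^bsub>R\<^esub>,
       zero = frac R S \<zero>\<^bsub>R\<^esub> \<one>\<^bsub>R\<^esub>,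
       add = (\<lambda>X Y. \<Union>(a, s)\<in>X. \<Union>(b, t)\<in>Y.
                frac R S (a \<otimes>\<^bsub>R\<^esub> t \<oplus>\<^bsub>R\<^esub> b \<otimes>\<^bsub>R\<^esub> s) (s \<otimes>\<^bsub>R\<^esub> t)) \<rparr>"

definition powers :: "('a, 'm) ring_scheme \<Rightarrow> 'a \<Rightarrow> 'a set" where
  "powers R e = range (\<lambda>n::nat. e [^]\<^bsub>R\<^esub> n)"

definition loc_at :: "('a, 'm) ring_scheme \<Rightarrow> 'a \<Rightarrow> ('a \<times> 'a) set ring" where
  "loc_at R e = localization R (powers R e)"

definition loc_image :: "('a, 'm) ring_scheme \<Rightarrow> 'a \<Rightarrow> 'a \<Rightarrow> ('a \<times> 'a) set" where
  "loc_image R e f = frac R (powers R e) f \<one>\<^bsub>R\<^esub>"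


section \<open>The Boolean algebra of idempotents\<close>

definition idem_alg :: "('a, 'm) ring_scheme \<Rightarrow> 'a gorder" where
  "idem_alg R = \<lparr> carrier = {e \<in> carrier R. e \<otimes>\<^bsub>R\<^esub> e = e}, eq = (=),
     le = (\<lambda>e f. e \<otimes>\<^bsub>R\<^esub> f = e) \<rparr>"

definition bmeet :: "('a, 'm) ring_scheme \<Rightarrow> 'a \<Rightarrow> 'a \<Rightarrow> 'a" where
  "bmeet R e f = e \<otimes>\<^bsub>R\<^esub> f"

definition bjoin :: "('a, 'm) ring_scheme \<Rightarrow> 'a \<Rightarrow> 'a \<Rightarrow> 'a" where
  "bjoin R e f = e \<oplus>\<^bsub>R\<^esub> f \<ominus>\<^bsub>R\<^esub> e \<otimes>\<^bsub>R\<^esub> f"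

definition bcompl :: "('a, 'm) ring_scheme \<Rightarrow> 'a \<Rightarrow> 'a" where
  "bcompl R e = \<one>\<^bsub>R\<^esub> \<ominus>\<^bsub>R\<^esub> e"

definition atoms :: "('a, 'm) ring_scheme \<Rightarrow> 'a set" where
  "atoms R = {a \<in> carrier (idem_alg R). a \<noteq> \<zero>\<^bsub>R\<^esub> \<and>
     (\<forall>b\<in>carrier (idem_alg R). b \<noteq> \<zero>\<^bsub>R\<^esub> \<and> b \<sqsubseteq>\<^bsub>idem_alg R\<^esub> a \<longrightarrow> b = a)}"

definition atomic :: "('a, 'm) ring_scheme \<Rightarrow> bool" where
  "atomic R \<longleftrightarrow>
     (\<forall>e\<in>carrier (idem_alg R). e \<noteq> \<zero>\<^bsub>R\<^esub> \<longrightarrow> (\<exists>a\<in>atoms R. a \<sqsubseteq>\<^bsub>idem_alg R\<^esub> e))"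

definition sat_atoms :: "('a, 'm) ring_scheme \<Rightarrow> rform \<Rightarrow> 'a list \<Rightarrow> 'a set" where
  "sat_atoms R \<Theta> fs = {a \<in> atoms R. sat (loc_at R a) (map (loc_image R a) fs) \<Theta>}"

definition bval_exists :: "('a, 'm) ring_scheme \<Rightarrow> rform \<Rightarrow> 'a list \<Rightarrow> bool" where
  "bval_exists R \<Theta> fs \<longleftrightarrow>
     (\<exists>s. least (idem_alg R) s (Upper (idem_alg R) (sat_atoms R \<Theta> fs)))"

text \<open>\<open>bval R \<Theta> fs\<close> is the Boolean value \<open>[[\<Theta>(fs)]]\<close>; it is meaningful when the supremum exists.\<close>

definition bval :: "('a, 'm) ring_scheme \<Rightarrow> rform \<Rightarrow> 'a list \<Rightarrow> 'a" where
  "bval R \<Theta> fs = \<Squnion>\<^bsub>idem_alg R\<^esub> (sat_atoms R \<Theta> fs)"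


section \<open>The axioms\<close>

definition bideal :: "('a, 'm) ring_scheme \<Rightarrow> 'a set \<Rightarrow> bool" where
  "bideal R F \<longleftrightarrow> F \<subseteq> carrier (idem_alg R) \<and> \<zero>\<^bsub>R\<^esub> \<in> F \<and>
     (\<forall>x\<in>F. \<forall>y\<in>F. bjoin R x y \<in> F) \<and>
     (\<forall>x\<in>F. \<forall>y\<in>carrier (idem_alg R). y \<sqsubseteq>\<^bsub>idem_alg R\<^esub> x \<longrightarrow> y \<in> F)"

text \<open>\<open>(\<bool>, F) \<Turnstile> T\<^sup>f\<^sup>i\<^sup>n\<close>, where \<open>\<bool>\<close> is the algebra of idempotents of \<open>R\<close>.\<close>

definition Tfin :: "('a, 'm) ring_scheme \<Rightarrow> 'a set \<Rightarrow> bool" where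
  "Tfin R F \<longleftrightarrow>
     infinite (carrier (idem_alg R)) \<and> atomic R \<and>
     bideal R F \<and> \<one>\<^bsub>R\<^esub> \<notin> F \<and>
     (\<forall>x\<in>carrier (idem_alg R). x \<notin> F \<longrightarrow>
        (\<exists>y\<in>carrier (idem_alg R).
           y \<sqsubset>\<^bsub>idem_alg R\<^esub> x \<and> y \<notin> F \<and> bmeet R x (bcompl R y) \<notin> F)) \<and>
     (\<forall>n::nat. \<forall>x\<in>carrier (idem_alg R).
        finite {a \<in> atoms R. a \<sqsubseteq>\<^bsub>idem_alg R\<^esub> x} \<and>
        card {a \<in> atoms R. a \<sqsubseteq>\<^bsub>idem_alg R\<^esub> x} \<le> n \<longrightarrow> x \<in> F)"

text \<open>In the fourth axiom the variable \<open>w\<close> of \<open>\<Theta>(x\<^sub>1,\<dots>,x\<^sub>n,w)\<close> is index 0, so that \<open>\<phi>(w)\<close> is \<open>\<phi>\<close>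
  itself and \<open>\<Theta>(f\<^sub>1,\<dots>,f\<^sub>n,g)\<close> is interpreted by \<open>g # fs\<close>.\<close>

definition axioms_A :: "rform \<Rightarrow> ('a, 'm) ring_scheme \<Rightarrow> 'a set \<Rightarrow> bool" where
  "axioms_A \<phi> R F \<longleftrightarrow>
     atomic R \<and>
     (\<forall>\<Theta> fs. set fs \<subseteq> carrier R \<and> fvf \<Theta> \<subseteq> {..<length fs} \<longrightarrow> bval_exists R \<Theta> fs) \<and>
     (\<forall>s t fs. set fs \<subseteq> carrier R \<and> fvf (Eq s t) \<subseteq> {..<length fs} \<longrightarrow>
        (sat R fs (Eq s t) \<longleftrightarrow> bval R (Eq s t) fs = \<one>\<^bsub>R\<^esub>)) \<and>
     Tfin R F \<and>
     (\<forall>\<Theta> fs. set fs \<subseteq> carrier R \<and> fvf \<Theta> \<subseteq> {..<Suc (length fs)} \<longrightarrow>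
        (\<exists>g\<in>carrier R.
           bmeet R (bval R (Ex \<Theta>) fs) (bcompl R (bval R (Ex (Conj \<phi> \<Theta>)) fs)) \<in> F \<longrightarrow>
           bmeet R (bval R (Ex \<Theta>) fs) (bcompl R (bval R \<Theta> (g # fs))) \<in> F)) \<and>
     (\<forall>x\<in>carrier R. bval R (Neg \<phi>) [x] \<in> F)"

text \<open>The formula \<open>gh = 1 \<and> \<phi>(g) \<and> \<not>\<phi>(h)\<close>, with \<open>g\<close> as index 0 and \<open>h\<close> as index 1.\<close>

definition sharp_form :: "rform \<Rightarrow> rform" where
  "sharp_form \<phi> =
     Conj (Eq (Mul (Var 0) (Var 1)) One) (Conj \<phi> (Neg (renf (\<lambda>i. i + 1) \<phi>)))"

definition sharp :: "rform \<Rightarrow> ('a, 'm) ring_scheme \<Rightarrow> 'a set \<Rightarrow> bool" where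
  "sharp \<phi> R F \<longleftrightarrow> (\<forall>e\<in>F. \<exists>g\<in>carrier R. \<exists>h\<in>carrier R.
     bval R (Eq (Var 0) One) [e] \<sqsubseteq>\<^bsub>idem_alg R\<^esub> bval R (sharp_form \<phi>) [g, h])"

end

theory Submission
  imports "HOL-Algebra.Multiplicative_Group" Defs
begin

text \<open>Since the algebra of idempotents is atomic, \<open>e \<le> [[\<Theta>]]\<close> holds exactly if every atom below \<open>e\<close>
  satisfies \<open>\<Theta>\<close>.  The stated equivalence then follows from \<open>(\<sharp>)\<close> and, conversely, from
  \<open>[[\<Theta>]] \<le> [[\<not>\<phi>(h)]]\<close> with \<open>[[\<not>\<phi>(h)]] \<in> Fin\<close>.  For definability, the localization at an idempotent
  \<open>a\<close> is \<open>R\<close> modulo the relation \<open>ax = ay\<close>, so truth in it is expressed in \<open>R\<close> by multiplying both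
  sides of every equation by \<open>a\<close>.\<close>

section \<open>Truth of formulas and its translation into localizations\<close>

lemma tval_cong: "(\<And>i. i \<in> fvt t \<Longrightarrow> ys ! i = xs ! i) \<Longrightarrow> tval R ys t = tval R xs t"
  by (induction t) auto

text \<open>Used to discard list entries beyond the free variables, such as a parameter trailing
  behind the arguments of \<open>\<Theta>\<close>.\<close>

lemma sat_cong: "(\<And>i. i \<in> fvf \<phi> \<Longrightarrow> ys ! i = xs ! i) \<Longrightarrow> sat R ys \<phi> \<longleftrightarrow> sat R xs \<phi>"
proof (induction \<phi> arbitrary: xs ys)
  case (Eq s t)
  then show ?case
    using tval_cong[of s ys xs R] tval_cong[of t ys xs R] by auto
next
  case (Neg \<phi>)
  then show ?case by (metis fvf.simps(2) sat.simps(2))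
next
  case (Conj \<phi> \<psi>)
  then show ?case by (metis UnCI fvf.simps(3) sat.simps(3))
next
  case (Ex \<phi>)
  have "sat R (a # ys) \<phi> \<longleftrightarrow> sat R (a # xs) \<phi>" for a
  proof (rule Ex.IH)
    fix i assume "i \<in> fvf \<phi>"
    then show "(a # ys) ! i = (a # xs) ! i"
      using Ex.prems by (cases i) auto
  qed
  then show ?case by simp
qed

text \<open>\<open>loc_form k \<Theta>\<close> expresses in \<open>R\<close> that \<open>\<Theta>\<close> holds in the localization at the value of index \<open>k\<close>;
  the variables of \<open>\<Theta>\<close> from \<open>k\<close> on are shifted to make room for this index.\<close>

primrec loc_form :: "nat \<Rightarrow> rform \<Rightarrow> rform" where
  "loc_form k (Eq s t) =
     (let r = (\<lambda>i. if i < k then i else Suc i)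
      in Eq (Mul (Var k) (rent r s)) (Mul (Var k) (rent r t)))"
| "loc_form k (Neg \<phi>) = Neg (loc_form k \<phi>)"
| "loc_form k (Conj \<phi> \<psi>) = Conj (loc_form k \<phi>) (loc_form k \<psi>)"
| "loc_form k (Ex \<phi>) = Ex (loc_form (Suc k) \<phi>)"

lemma fvt_rent: "fvt (rent r t) = r ` fvt t"
  by (induction t) auto

text \<open>The translation inserts one new index, so the bound rises by one;
  \<open>k \<le> n\<close> keeps the index \<open>k\<close> itself inside the new bound.\<close>

lemma fvf_loc_form:
  "fvf \<phi> \<subseteq> {..<n} \<Longrightarrow> k \<le> n \<Longrightarrow> fvf (loc_form k \<phi>) \<subseteq> {..<Suc n}"
proof (induction \<phi> arbitrary: k n)
  case (Eq s t)
  then show ?case by (auto simp: fvt_rent Let_def less_Suc_eq)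
next
  case (Ex \<phi>)
  have "fvf \<phi> \<subseteq> {..<Suc n}"
  proof
    fix i assume "i \<in> fvf \<phi>"
    then show "i \<in> {..<Suc n}"
      using Ex.prems(1) by (cases i) auto
  qed
  then have "fvf (loc_form (Suc k) \<phi>) \<subseteq> {..<Suc (Suc n)}"
    using Ex by simp
  then show ?case by auto
qed auto

context cring
begin

lemma tval_closed:
  "\<lbrakk>set xs \<subseteq> carrier R; fvt t \<subseteq> {..<length xs}\<rbrakk> \<Longrightarrow> tval R xs t \<in> carrier R"
  by (induction t) (auto simp: subset_iff)


subsection \<open>Localization at an idempotent\<close>

text \<open>The only powers of an idempotent are 1 and \<open>a\<close>, and \<open>a\<close>
  absorbs both. This makes all denominators disappear after multiplication by
  \<open>a\<close>.\<close>

lemma powers_idem: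
  assumes "a \<in> carrier R" "a \<otimes> a = a" "s \<in> powers R a"
  shows "s \<in> carrier R" "a \<otimes> s = a"
proof -
  obtain n :: nat where s: "s = a [^] n"
    using assms(3) by (auto simp: powers_def)
  show "s \<in> carrier R"
    using s assms by simp
  have "a \<otimes> a [^] n = a"
  proof (induction n)
    case (Suc n)
    then show ?case
      using assms(1,2) by (simp add: m_assoc[symmetric])
  qed (use assms in simp)
  then show "a \<otimes> s = a"
    by (simp add: s)
qed

lemma one_in_powers: "\<one> \<in> powers R a"
  unfolding powers_def by (rule range_eqI[of _ _ 0]) simp

lemma self_in_powers: "a \<in> carrier R \<Longrightarrow> a \<in> powers R a"
  unfolding powers_def by (rule range_eqI[of _ _ 1]) simp

lemma mult_in_powers:
  assumes "a \<in> carrier R" "s \<in> powers R a" "t \<in> powers R a"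
  shows "s \<otimes> t \<in> powers R a"
proof -
  obtain m n :: nat where "s = a [^] m" "t = a [^] n"
    using assms(2,3) by (auto simp: powers_def)
  then have "s \<otimes> t = a [^] (m + n)"
    using assms(1) by (simp add: nat_pow_mult)
  then show ?thesis
    unfolding powers_def by blast
qed

text \<open>If some power \<open>u\<close> annihilates the difference, then so does
  \<open>a\<close>, because \<open>a \<otimes> u = a\<close>. Hence \<open>a\<close> serves as a
  universal witness, and multiplying by it also erases the denominators \<open>s\<close> and
  \<open>t\<close>.\<close>

lemma frac_rel_idem:
  assumes a: "a \<in> carrier R" "a \<otimes> a = a"
  shows "((x, s), (y, t)) \<in> frac_rel R (powers R a) \<longleftrightarrow>
    x \<in> carrier R \<and> y \<in> carrier R \<and> s \<in> powers R a \<and> t \<in> powers R a \<and> a \<otimes> x = a \<otimes> y"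
proof -
  have "(\<exists>u\<in>powers R a. u \<otimes> (x \<otimes> t \<ominus> y \<otimes> s) = \<zero>) \<longleftrightarrow> a \<otimes> x = a \<otimes> y"
    if x: "x \<in> carrier R" "y \<in> carrier R" and s: "s \<in> powers R a" and t: "t \<in> powers R a"
  proof -
    note S = powers_idem[OF a s]
    note T = powers_idem[OF a t]
    have expand: "a \<otimes> (x \<otimes> t \<ominus> y \<otimes> s) = a \<otimes> x \<ominus> a \<otimes> y"
    proof -
      have "a \<otimes> (x \<otimes> t \<ominus> y \<otimes> s) = (a \<otimes> t) \<otimes> x \<ominus> (a \<otimes> s) \<otimes> y"
        using a x S(1) T(1) by algebra
      then show ?thesis by (simp add: S T)
    qed
    have "a \<otimes> (x \<otimes> t \<ominus> y \<otimes> s) = \<zero>" if u: "u \<in> powers R a" "u \<otimes> (x \<otimes> t \<ominus> y \<otimes> s) = \<zero>" for u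
    proof -
      note U = powers_idem[OF a u(1)]
      have "a \<otimes> (x \<otimes> t \<ominus> y \<otimes> s) = (a \<otimes> u) \<otimes> (x \<otimes> t \<ominus> y \<otimes> s)"
        by (simp add: U)
      also have "\<dots> = a \<otimes> (u \<otimes> (x \<otimes> t \<ominus> y \<otimes> s))"
        using a x S(1) T(1) U(1) by (simp add: m_assoc)
      finally show ?thesis
        using a u(2) by simp
    qed
    then have "(\<exists>u\<in>powers R a. u \<otimes> (x \<otimes> t \<ominus> y \<otimes> s) = \<zero>) \<longleftrightarrow> a \<otimes> x \<ominus> a \<otimes> y = \<zero>"
      using self_in_powers[OF a(1)] expand by auto
    also have "\<dots> \<longleftrightarrow> a \<otimes> x = a \<otimes> y"
      using a x by (simp add: r_right_minus_eq)
    finally show ?thesis .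
  qed
  then show ?thesis
    unfolding frac_rel_def by blast
qed

lemma frac_idem:
  assumes "a \<in> carrier R" "a \<otimes> a = a" "x \<in> carrier R" "s \<in> powers R a"
  shows "frac R (powers R a) x s = {y \<in> carrier R. a \<otimes> y = a \<otimes> x} \<times> powers R a"
  unfolding frac_def using assms by (auto simp: frac_rel_idem)

lemma loc_image_idem:
  assumes "a \<in> carrier R" "a \<otimes> a = a" "x \<in> carrier R"
  shows "loc_image R a x = {y \<in> carrier R. a \<otimes> y = a \<otimes> x} \<times> powers R a"
  unfolding loc_image_def using assms by (simp add: frac_idem one_in_powers)

lemma frac_eq_loc_image:
  assumes "a \<in> carrier R" "a \<otimes> a = a" "x \<in> carrier R" "s \<in> powers R a"
  shows "frac R (powers R a) x s = loc_image R a x"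
  using assms by (simp add: frac_idem loc_image_idem)

lemma loc_image_eq_iff:
  assumes "a \<in> carrier R" "a \<otimes> a = a" "x \<in> carrier R" "y \<in> carrier R"
  shows "loc_image R a x = loc_image R a y \<longleftrightarrow> a \<otimes> x = a \<otimes> y"
proof
  assume "loc_image R a x = loc_image R a y"
  moreover have "(x, \<one>) \<in> loc_image R a x"
    using assms by (simp add: loc_image_idem one_in_powers)
  ultimately show "a \<otimes> x = a \<otimes> y"
    using assms by (auto simp: loc_image_idem)
qed (use assms in \<open>simp add: loc_image_idem\<close>)

lemma carrier_loc_at:
  assumes "a \<in> carrier R" "a \<otimes> a = a"
  shows "carrier (loc_at R a) = loc_image R a ` carrier R"
proof -
  have "carrier (loc_at R a) = (\<lambda>(x, s). frac R (powers R a) x s) ` (carrier R \<times> powers R a)"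
    by (auto simp: loc_at_def localization_def quotient_def frac_def)
  also have "\<dots> = loc_image R a ` carrier R"
  proof
    show "(\<lambda>(x, s). frac R (powers R a) x s) ` (carrier R \<times> powers R a) \<subseteq> loc_image R a ` carrier R"
      using frac_eq_loc_image[OF assms] by auto
    show "loc_image R a ` carrier R \<subseteq> (\<lambda>(x, s). frac R (powers R a) x s) ` (carrier R \<times> powers R a)"
      using one_in_powers[of a] by (force simp: loc_image_def)
  qed
  finally show ?thesis .
qed

text \<open>The operations of \<open>localization\<close> are unions over all representatives of two
  classes. Such a union collapses to one value once the value is independent of the representatives;
  \<open>p\<close> and \<open>q\<close> ensure that the union is not empty.\<close>

lemma UN_pair_eq:
  assumes "p \<in> X" "q \<in> Y"
    and "\<And>x s y t. \<lbrakk>(x, s) \<in> X; (y, t) \<in> Y\<rbrakk> \<Longrightarrow> F x s y t = Z"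
  shows "(\<Union>(x, s)\<in>X. \<Union>(y, t)\<in>Y. F x s y t) = Z"
proof -
  have "(\<Union>(x, s)\<in>X. \<Union>(y, t)\<in>Y. F x s y t) = (\<Union>(x, s)\<in>X. \<Union>(y, t)\<in>Y. Z)"
    using assms(3) by (intro SUP_cong refl) (auto intro!: SUP_cong)
  also have "\<dots> = Z"
    using assms(1,2) by auto
  finally show ?thesis .
qed

lemma loc_image_mult:
  assumes a: "a \<in> carrier R" "a \<otimes> a = a" and xy: "x \<in> carrier R" "y \<in> carrier R"
  shows "loc_image R a x \<otimes>\<^bsub>loc_at R a\<^esub> loc_image R a y = loc_image R a (x \<otimes> y)"
proof -
  have eq: "frac R (powers R a) (x' \<otimes> y') (s \<otimes> t) = loc_image R a (x \<otimes> y)"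
    if "(x', s) \<in> loc_image R a x" "(y', t) \<in> loc_image R a y" for x' s y' t
  proof -
    have st: "x' \<in> carrier R" "y' \<in> carrier R" "s \<in> powers R a" "t \<in> powers R a"
      "a \<otimes> x' = a \<otimes> x" "a \<otimes> y' = a \<otimes> y"
      using that a xy by (auto simp: loc_image_idem)
    \<comment> \<open>The factor \<open>a\<close> is moved first to \<open>x'\<close> and then to
      \<open>y'\<close>, so that each representative can be exchanged in turn.\<close>
    have "a \<otimes> (x' \<otimes> y') = (a \<otimes> x') \<otimes> y'" "(a \<otimes> x) \<otimes> y' = x \<otimes> (a \<otimes> y')"
      "x \<otimes> (a \<otimes> y) = a \<otimes> (x \<otimes> y)"
      using a(1) xy st(1,2) by (simp_all add: m_ac)
    then have "a \<otimes> (x' \<otimes> y') = a \<otimes> (x \<otimes> y)"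
      by (simp add: st)
    then show ?thesis
      using st a xy by (simp add: frac_eq_loc_image mult_in_powers loc_image_eq_iff)
  qed
  have "(x, \<one>) \<in> loc_image R a x" "(y, \<one>) \<in> loc_image R a y"
    using a xy by (simp_all add: loc_image_idem one_in_powers)
  from UN_pair_eq[OF this eq] show ?thesis
    by (simp add: loc_at_def localization_def)
qed

lemma loc_image_add:
  assumes a: "a \<in> carrier R" "a \<otimes> a = a" and xy: "x \<in> carrier R" "y \<in> carrier R"
  shows "loc_image R a x \<oplus>\<^bsub>loc_at R a\<^esub> loc_image R a y = loc_image R a (x \<oplus> y)"
proof -
  have eq: "frac R (powers R a) (x' \<otimes> t \<oplus> y' \<otimes> s) (s \<otimes> t) = loc_image R a (x \<oplus> y)"
    if "(x', s) \<in> loc_image R a x" "(y', t) \<in> loc_image R a y" for x' s y' t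
  proof -
    have st: "x' \<in> carrier R" "y' \<in> carrier R" "s \<in> powers R a" "t \<in> powers R a"
      "a \<otimes> x' = a \<otimes> x" "a \<otimes> y' = a \<otimes> y"
      using that a xy by (auto simp: loc_image_idem)
    note S = powers_idem[OF a st(3)]
    note T = powers_idem[OF a st(4)]
    have "a \<otimes> (x' \<otimes> t \<oplus> y' \<otimes> s) = (a \<otimes> t) \<otimes> x' \<oplus> (a \<otimes> s) \<otimes> y'"
      using a(1) st(1,2) S(1) T(1) by algebra
    also have "\<dots> = a \<otimes> x \<oplus> a \<otimes> y"
      by (simp add: S T st)
    also have "\<dots> = a \<otimes> (x \<oplus> y)"
      using a(1) xy by (simp add: r_distr)
    finally show ?thesis
      using st S T a xy by (simp add: frac_eq_loc_image mult_in_powers loc_image_eq_iff)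
  qed
  have "(x, \<one>) \<in> loc_image R a x" "(y, \<one>) \<in> loc_image R a y"
    using a xy by (simp_all add: loc_image_idem one_in_powers)
  from UN_pair_eq[OF this eq] show ?thesis
    by (simp add: loc_at_def localization_def)
qed

lemma tval_loc_at:
  assumes "a \<in> carrier R" "a \<otimes> a = a" "set xs \<subseteq> carrier R"
  shows "fvt t \<subseteq> {..<length xs} \<Longrightarrow>
    tval (loc_at R a) (map (loc_image R a) xs) t = loc_image R a (tval R xs t)"
proof (induction t)
  case Zero
  then show ?case by (simp add: loc_at_def localization_def loc_image_def)
next
  case One
  then show ?case by (simp add: loc_at_def localization_def loc_image_def)
qed (use assms in \<open>auto simp: loc_image_add loc_image_mult tval_closed\<close>)

text \<open>Each quantifier pushes a new entry in front of \<open>a\<close>, so the induction needs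
  an arbitrary prefix \<open>xs\<close>, whose length is the index of \<open>a\<close>. In the
  quantifier case witnesses lift to \<open>R\<close> because \<open>loc_image R a\<close> maps onto
  the localization.\<close>

lemma sat_loc_form:
  assumes a: "a \<in> carrier R" "a \<otimes> a = a"
  shows "\<lbrakk>set (xs @ ys) \<subseteq> carrier R; fvf \<phi> \<subseteq> {..<length (xs @ ys)}\<rbrakk> \<Longrightarrow>
    sat R (xs @ a # ys) (loc_form (length xs) \<phi>) \<longleftrightarrow>
    sat (loc_at R a) (map (loc_image R a) (xs @ ys)) \<phi>"
proof (induction \<phi> arbitrary: xs)
  case (Eq s t)
  \<comment> \<open>The renaming skips exactly the position of \<open>a\<close>.\<close>
  have "tval R (xs @ a # ys) (rent (\<lambda>i. if i < length xs then i else Suc i) u) = tval R (xs @ ys) u" for u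
    by (rule tval_rent) (auto simp: nth_append Suc_diff_le)
  moreover have "tval (loc_at R a) (map (loc_image R a) (xs @ ys)) u = loc_image R a (tval R (xs @ ys) u)"
    "tval R (xs @ ys) u \<in> carrier R" if "u \<in> {s, t}" for u
    using that Eq by (auto intro!: tval_loc_at[OF a] tval_closed simp del: map_append)
  ultimately show ?case
    using a by (simp add: Let_def loc_image_eq_iff nth_append del: map_append)
next
  case (Ex \<phi>)
  have "fvf \<phi> \<subseteq> {..<Suc (length (xs @ ys))}"
  proof
    fix i assume "i \<in> fvf \<phi>"
    then show "i \<in> {..<Suc (length (xs @ ys))}"
      using Ex.prems(2) by (cases i) auto
  qed
  then have "sat R ((x # xs) @ a # ys) (loc_form (length (x # xs)) \<phi>) \<longleftrightarrow>
      sat (loc_at R a) (map (loc_image R a) ((x # xs) @ ys)) \<phi>" if "x \<in> carrier R" for x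
    using that Ex.prems by (intro Ex.IH) auto
  then show ?case
    using a by (simp add: carrier_loc_at)
qed auto


subsection \<open>Boolean values\<close>

text \<open>A nonzero product would be a nonzero idempotent below both atoms, hence equal to each of
  them.\<close>

lemma atoms_disjoint:
  assumes "a \<in> atoms R" "b \<in> atoms R" "a \<noteq> b"
  shows "a \<otimes> b = \<zero>"
proof (rule ccontr)
  assume nz: "a \<otimes> b \<noteq> \<zero>"
  have c: "a \<in> carrier R" "b \<in> carrier R" "a \<otimes> a = a" "b \<otimes> b = b"
    using assms by (auto simp: atoms_def idem_alg_def)
  have 1: "(a \<otimes> b) \<otimes> a = a \<otimes> b" "(a \<otimes> b) \<otimes> b = a \<otimes> b"
    using c by (metis m_assoc m_comm, metis m_assoc)
  then have "(a \<otimes> b) \<otimes> (a \<otimes> b) = a \<otimes> b"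
    using c by (simp add: m_assoc[symmetric])
  then have "a \<otimes> b = a" "a \<otimes> b = b"
    using assms(1,2) nz c 1 by (auto simp: atoms_def idem_alg_def)
  then show False
    using assms(3) by simp
qed

text \<open>\<open>bval\<close> is given by a choice operator; existence of the supremum turns the
  choice into the actual least upper bound.\<close>

lemma bval_least:
  assumes "bval_exists R \<Theta> fs"
  shows "least (idem_alg R) (bval R \<Theta> fs) (Upper (idem_alg R) (sat_atoms R \<Theta> fs))"
  using assms someI_ex unfolding bval_exists_def bval_def sup_def by (metis (no_types, lifting))

lemma bval_closed:
  "bval_exists R \<Theta> fs \<Longrightarrow> bval R \<Theta> fs \<in> carrier (idem_alg R)"
  using bval_least[of \<Theta> fs] by (auto simp: least_def Upper_def)

lemma idem_compl:
  "x \<in> carrier (idem_alg R) \<Longrightarrow> \<one> \<ominus> x \<in> carrier (idem_alg R)"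
  by (simp add: idem_alg_def) algebra

lemma mult_compl:
  assumes "x \<in> carrier R" "y \<in> carrier R"
  shows "x \<otimes> (\<one> \<ominus> y) = x \<ominus> x \<otimes> y"
  using assms by algebra

lemma le_idem_trans:
  assumes "x \<sqsubseteq>\<^bsub>idem_alg R\<^esub> y" "y \<sqsubseteq>\<^bsub>idem_alg R\<^esub> z"
    "x \<in> carrier R" "y \<in> carrier R" "z \<in> carrier R"
  shows "x \<sqsubseteq>\<^bsub>idem_alg R\<^esub> z"
  using assms by (auto simp: idem_alg_def) (metis m_assoc)

text \<open>The supremum acquires no new atoms: if \<open>a\<close> is not among the satisfying
  atoms, it is disjoint from all of them. Then the complement of \<open>a\<close> is an upper bound,
  and \<open>a\<close> below the supremum would force \<open>a = \<zero>\<close>.\<close>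

lemma atom_le_bval_iff:
  assumes ex: "bval_exists R \<Theta> fs" and a: "a \<in> atoms R"
  shows "a \<sqsubseteq>\<^bsub>idem_alg R\<^esub> bval R \<Theta> fs \<longleftrightarrow> a \<in> sat_atoms R \<Theta> fs"
proof
  have ac: "a \<in> carrier (idem_alg R)" "a \<in> carrier R" "a \<otimes> a = a" "a \<noteq> \<zero>"
    using a by (auto simp: atoms_def idem_alg_def)
  assume le: "a \<sqsubseteq>\<^bsub>idem_alg R\<^esub> bval R \<Theta> fs"
  show "a \<in> sat_atoms R \<Theta> fs"
  proof (rule ccontr)
    assume n: "a \<notin> sat_atoms R \<Theta> fs"
    have "b \<sqsubseteq>\<^bsub>idem_alg R\<^esub> \<one> \<ominus> a" if "b \<in> sat_atoms R \<Theta> fs" for b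
    proof -
      have b: "b \<in> atoms R" "b \<in> carrier R"
        using that by (auto simp: sat_atoms_def atoms_def idem_alg_def)
      then have "b \<otimes> a = \<zero>"
        using atoms_disjoint[OF b(1) a] n that by auto
      then have "b \<otimes> (\<one> \<ominus> a) = b \<ominus> \<zero>"
        using b ac by (simp add: mult_compl)
      then show ?thesis
        using b by (simp add: idem_alg_def minus_eq)
    qed
    then have "\<one> \<ominus> a \<in> Upper (idem_alg R) (sat_atoms R \<Theta> fs)"
      using idem_compl[OF ac(1)] by (auto simp: Upper_def)
    then have "bval R \<Theta> fs \<sqsubseteq>\<^bsub>idem_alg R\<^esub> \<one> \<ominus> a"
      using bval_least[OF ex] by (auto simp: least_def)
    then have "a \<sqsubseteq>\<^bsub>idem_alg R\<^esub> \<one> \<ominus> a"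
      using le_idem_trans[OF le] bval_closed[OF ex] ac by (auto simp: idem_alg_def)
    then have "a \<otimes> (\<one> \<ominus> a) = a"
      by (simp add: idem_alg_def)
    then show False
      using ac by (simp add: mult_compl) (metis r_right_minus_eq)
  qed
next
  assume "a \<in> sat_atoms R \<Theta> fs"
  moreover have "a \<in> carrier (idem_alg R)"
    using a by (simp add: atoms_def)
  ultimately show "a \<sqsubseteq>\<^bsub>idem_alg R\<^esub> bval R \<Theta> fs"
    using bval_least[OF ex] by (auto simp: least_def Upper_def)
qed

lemma le_bval_iff:
  assumes "atomic R" and ex: "bval_exists R \<Theta> fs" and e: "e \<in> carrier (idem_alg R)"
  shows "e \<sqsubseteq>\<^bsub>idem_alg R\<^esub> bval R \<Theta> fs \<longleftrightarrow>
    (\<forall>a\<in>atoms R. a \<sqsubseteq>\<^bsub>idem_alg R\<^esub> e \<longrightarrow> sat (loc_at R a) (map (loc_image R a) fs) \<Theta>)"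
    (is "?L \<longleftrightarrow> ?R")
proof
  have ec: "e \<in> carrier R" "e \<otimes> e = e"
    using e by (auto simp: idem_alg_def)
  have vc: "bval R \<Theta> fs \<in> carrier R" "bval R \<Theta> fs \<otimes> bval R \<Theta> fs = bval R \<Theta> fs"
    using bval_closed[OF ex] by (auto simp: idem_alg_def)
  have ac: "a \<in> carrier R" "a \<noteq> \<zero>" if "a \<in> atoms R" for a
    using that by (auto simp: atoms_def idem_alg_def)
  {
    assume ?L
    then show ?R
      using le_idem_trans[of _ e] atom_le_bval_iff[OF ex] ac ec vc
      by (fastforce simp: sat_atoms_def)
  next
    assume r: ?R
    \<comment> \<open>The part of \<open>e\<close> outside the Boolean value. An atom below it would
      lie below \<open>e\<close>, hence by assumption below the Boolean value, from which it is
      disjoint; so atomicity gives \<open>?d = \<zero>\<close>.\<close>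
    let ?d = "e \<otimes> (\<one> \<ominus> bval R \<Theta> fs)"
    have v: "(\<one> \<ominus> bval R \<Theta> fs) \<otimes> (\<one> \<ominus> bval R \<Theta> fs) = \<one> \<ominus> bval R \<Theta> fs"
      using idem_compl[OF bval_closed[OF ex]] by (simp add: idem_alg_def)
    have "?d \<otimes> ?d = (e \<otimes> e) \<otimes> ((\<one> \<ominus> bval R \<Theta> fs) \<otimes> (\<one> \<ominus> bval R \<Theta> fs))"
      using ec(1) vc(1) by algebra
    then have d: "?d \<in> carrier (idem_alg R)"
      using ec vc(1) v by (simp add: idem_alg_def)
    have "?d = \<zero>"
    proof (rule ccontr)
      assume "?d \<noteq> \<zero>"
      then obtain a where a: "a \<in> atoms R" "a \<sqsubseteq>\<^bsub>idem_alg R\<^esub> ?d"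
        using assms(1) d unfolding atomic_def by blast
      have ad: "a \<otimes> ?d = a"
        using a by (simp add: idem_alg_def)
      have "a \<otimes> ?d \<otimes> e = a \<otimes> ((e \<otimes> e) \<otimes> (\<one> \<ominus> bval R \<Theta> fs))"
        using ac[OF a(1)] ec(1) vc(1) by algebra
      then have "a \<sqsubseteq>\<^bsub>idem_alg R\<^esub> e"
        using ad ec by (simp add: idem_alg_def)
      then have "a \<sqsubseteq>\<^bsub>idem_alg R\<^esub> bval R \<Theta> fs"
        using r a atom_le_bval_iff[OF ex a(1)] by (simp add: sat_atoms_def)
      then have av: "a \<otimes> bval R \<Theta> fs = a"
        by (simp add: idem_alg_def)
      have "a \<otimes> ?d = e \<otimes> (a \<ominus> a \<otimes> bval R \<Theta> fs)"
        using ac[OF a(1)] ec(1) vc(1) by algebra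
      then show False
        using ad av ac[OF a(1)] ec(1) by (simp add: minus_eq r_neg)
    qed
    then show ?L
      using ec vc by (simp add: mult_compl r_right_minus_eq idem_alg_def)
  }
qed

end


subsection \<open>Definability\<close>

definition atom_form :: rform where
  "atom_form = Conj (Eq (Mul (Var 0) (Var 0)) (Var 0)) (Conj (Neg (Eq (Var 0) Zero))
     (Neg (Ex (Conj (Eq (Mul (Var 0) (Var 0)) (Var 0)) (Conj (Neg (Eq (Var 0) Zero))
        (Conj (Eq (Mul (Var 0) (Var 1)) (Var 0)) (Neg (Eq (Var 0) (Var 1)))))))))"

lemma sat_atom_form:
  "a \<in> carrier R \<Longrightarrow> sat R (a # xs) atom_form \<longleftrightarrow> a \<in> atoms R"
  by (auto simp: atom_form_def atoms_def idem_alg_def)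

text \<open>Under the quantifiers index 0 is the atom, 1 and 2 are the variables of \<open>\<Theta>\<close>, and 3 is the
  idempotent tested.\<close>

definition below_bval_form :: "rform \<Rightarrow> rform" where
  "below_bval_form \<Theta> = Conj (Eq (Mul (Var 0) (Var 0)) (Var 0))
     (Ex (Ex (Neg (Ex (Conj atom_form
        (Conj (Eq (Mul (Var 0) (Var 3)) (Var 0)) (Neg (loc_form 0 \<Theta>))))))))"

lemma fvf_below_bval_form:
  assumes "fvf \<Theta> \<subseteq> {..<2}"
  shows "fvf (below_bval_form \<Theta>) \<subseteq> {..<1}"
  using fvf_loc_form[OF assms, of 0]
  by (auto simp: below_bval_form_def atom_form_def)

lemma (in cring) sat_below_bval_form:
  assumes "atomic R" "fvf \<Theta> \<subseteq> {..<2}"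
    and ex: "\<And>g h. \<lbrakk>g \<in> carrier R; h \<in> carrier R\<rbrakk> \<Longrightarrow> bval_exists R \<Theta> [g, h]"
    and e: "e \<in> carrier R"
  shows "sat R [e] (below_bval_form \<Theta>) \<longleftrightarrow> e \<in> carrier (idem_alg R) \<and>
    (\<exists>g\<in>carrier R. \<exists>h\<in>carrier R. e \<sqsubseteq>\<^bsub>idem_alg R\<^esub> bval R \<Theta> [g, h])"
proof -
  have loc: "sat R [a, g, h, e] (loc_form 0 \<Theta>) \<longleftrightarrow>
      sat (loc_at R a) (map (loc_image R a) [g, h]) \<Theta>"
    if "a \<in> atoms R" "g \<in> carrier R" "h \<in> carrier R" for a g h
  proof -
    \<comment> \<open>With an empty prefix the atom sits at index 0, and \<open>e\<close> counts as
      a further parameter of \<open>\<Theta>\<close>.\<close>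
    have "sat R ([] @ a # [g, h, e]) (loc_form (length ([] :: 'a list)) \<Theta>) \<longleftrightarrow>
        sat (loc_at R a) (map (loc_image R a) ([] @ [g, h, e])) \<Theta>"
      using that e assms(2) by (intro sat_loc_form) (auto simp: atoms_def idem_alg_def)
    also have "\<dots> \<longleftrightarrow> sat (loc_at R a) (map (loc_image R a) [g, h]) \<Theta>"
      using assms(2) by (intro sat_cong) (auto simp: subset_iff less_Suc_eq numeral_2_eq_2)
    finally show ?thesis by simp
  qed
  have *: "sat R [g, h, e] (Neg (Ex (Conj atom_form
        (Conj (Eq (Mul (Var 0) (Var 3)) (Var 0)) (Neg (loc_form 0 \<Theta>)))))) \<longleftrightarrow>
      e \<sqsubseteq>\<^bsub>idem_alg R\<^esub> bval R \<Theta> [g, h]"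
    if "g \<in> carrier R" "h \<in> carrier R" "e \<in> carrier (idem_alg R)" for g h
  proof -
    have "sat R [g, h, e] (Neg (Ex (Conj atom_form
        (Conj (Eq (Mul (Var 0) (Var 3)) (Var 0)) (Neg (loc_form 0 \<Theta>)))))) \<longleftrightarrow>
      (\<forall>a\<in>atoms R. a \<otimes> e = a \<longrightarrow> sat R [a, g, h, e] (loc_form 0 \<Theta>))"
      by (auto simp: sat_atom_form) (auto simp: atoms_def idem_alg_def)
    then show ?thesis
      using le_bval_iff[OF assms(1) ex that(3)] that loc by (simp add: idem_alg_def)
  qed
  \<comment> \<open>The outer quantifier supplies \<open>h\<close> and the inner one
    \<open>g\<close>, since the innermost binder has index 0.\<close>
  have "sat R [e] (below_bval_form \<Theta>) \<longleftrightarrow> e \<in> carrier (idem_alg R) \<and>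
    (\<exists>h\<in>carrier R. \<exists>g\<in>carrier R. sat R [g, h, e] (Neg (Ex (Conj atom_form
        (Conj (Eq (Mul (Var 0) (Var 3)) (Var 0)) (Neg (loc_form 0 \<Theta>)))))))"
    using e by (auto simp: below_bval_form_def idem_alg_def)
  then show ?thesis
    using * by blast
qed

section \<open>The formula of condition \<open>(\<sharp>)\<close> and the definability of
  \<open>Fin\<close>\<close>

lemma fvf_renf: "fvf (renf r \<phi>) \<subseteq> r ` fvf \<phi>"
proof (induction \<phi> arbitrary: r)
  case (Ex \<phi>)
  show ?case
  proof
    fix i assume "i \<in> fvf (renf r (Ex \<phi>))"
    then obtain j where "j \<in> fvf \<phi>" "Suc i = case_nat 0 (Suc \<circ> r) j"
      using Ex.IH[of "case_nat 0 (Suc \<circ> r)"] by auto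
    then show "i \<in> r ` fvf (Ex \<phi>)"
      by (cases j) auto
  qed
qed (simp_all add: fvt_rent image_Un le_supI1 le_supI2)

lemma fvf_sharp_form:
  assumes "fvf \<phi> \<subseteq> {..<1}"
  shows "fvf (sharp_form \<phi>) \<subseteq> {..<2}"
  using assms fvf_renf[of "\<lambda>i. i + 1" \<phi>] by (fastforce simp: sharp_form_def)

text \<open>The shift by one makes the second copy of \<open>\<phi>\<close> read \<open>h\<close>.
  Here \<open>R\<close> is an arbitrary structure, so the lemma applies in every localization at an
  atom.\<close>

lemma sat_sharp_formD:
  assumes "fvf \<phi> \<subseteq> {..<1}" "sat R [g, h] (sharp_form \<phi>)"
  shows "\<not> sat R [h] \<phi>"
proof -
  have "sat R [g, h] (renf (\<lambda>i. i + 1) \<phi>) \<longleftrightarrow> sat R [h] \<phi>"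
    using assms(1) by (intro sat_renf) auto
  then show ?thesis
    using assms(2) by (simp add: sharp_form_def)
qed

theorem mainTheorem5:
  fixes R :: "('a, 'm) ring_scheme" and Fin :: "'a set" and \<phi> :: rform
  assumes "fvf \<phi> \<subseteq> {..<1}"
    and "cring R" and "\<one>\<^bsub>R\<^esub> \<noteq> \<zero>\<^bsub>R\<^esub>"
    and "axioms_A \<phi> R Fin"
    and "sharp \<phi> R Fin"
  shows "definable R Fin \<and>
    (\<forall>e\<in>carrier (idem_alg R).
       e \<in> Fin \<longleftrightarrow>
       (\<exists>g\<in>carrier R. \<exists>h\<in>carrier R.
          e \<sqsubseteq>\<^bsub>idem_alg R\<^esub> bval R (sharp_form \<phi>) [g, h]))"
proof -
  interpret cring R by fact
  have at: "atomic R" and id: "bideal R Fin"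
    and ex: "\<And>\<Theta> fs. \<lbrakk>set fs \<subseteq> carrier R; fvf \<Theta> \<subseteq> {..<length fs}\<rbrakk> \<Longrightarrow> bval_exists R \<Theta> fs"
    and neg: "\<And>x. x \<in> carrier R \<Longrightarrow> bval R (Neg \<phi>) [x] \<in> Fin"
    using assms(4) by (simp_all add: axioms_A_def Tfin_def)
  have exs: "bval_exists R (sharp_form \<phi>) [g, h]" if "g \<in> carrier R" "h \<in> carrier R" for g h
    using that fvf_sharp_form[OF assms(1)] by (intro ex) (auto simp: numeral_2_eq_2)
  have main: "e \<in> Fin \<longleftrightarrow> (\<exists>g\<in>carrier R. \<exists>h\<in>carrier R.
          e \<sqsubseteq>\<^bsub>idem_alg R\<^esub> bval R (sharp_form \<phi>) [g, h])" if e: "e \<in> carrier (idem_alg R)" for e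
  proof
    have ec: "e \<in> carrier R"
      using e by (simp add: idem_alg_def)
    assume "e \<in> Fin"
    then obtain g h where gh: "g \<in> carrier R" "h \<in> carrier R"
      and le: "bval R (Eq (Var 0) One) [e] \<sqsubseteq>\<^bsub>idem_alg R\<^esub> bval R (sharp_form \<phi>) [g, h]"
      using assms(5) unfolding sharp_def by blast
    have ex1: "bval_exists R (Eq (Var 0) One) [e]"
      using ec by (intro ex) auto
    \<comment> \<open>An atom \<open>a\<close> below \<open>e\<close> satisfies
      \<open>ae = a1\<close>, so \<open>e\<close> becomes 1 in the localization at \<open>a\<close>.
      This yields \<open>e \<le> [[e = 1]]\<close>, after which \<open>(\<sharp>)\<close> applies by
      transitivity.\<close>
    have "sat (loc_at R a) (map (loc_image R a) [e]) (Eq (Var 0) One)"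
      if a: "a \<in> atoms R" "a \<sqsubseteq>\<^bsub>idem_alg R\<^esub> e" for a
    proof -
      have "a \<in> carrier R" "a \<otimes>\<^bsub>R\<^esub> a = a" "a \<otimes>\<^bsub>R\<^esub> e = a"
        using a by (auto simp: atoms_def idem_alg_def)
      moreover from this have "sat R ([] @ a # [e]) (loc_form (length ([] :: 'a list)) (Eq (Var 0) One))"
        by (simp add: Let_def)
      ultimately show ?thesis
        using ec by (subst (asm) sat_loc_form) auto
    qed
    then have "e \<sqsubseteq>\<^bsub>idem_alg R\<^esub> bval R (Eq (Var 0) One) [e]"
      using le_bval_iff[OF at ex1 e] by blast
    then have "e \<sqsubseteq>\<^bsub>idem_alg R\<^esub> bval R (sharp_form \<phi>) [g, h]"
      using le_idem_trans[OF _ le ec] bval_closed[OF ex1] bval_closed[OF exs[OF gh]]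
      by (simp add: idem_alg_def)
    then show "\<exists>g\<in>carrier R. \<exists>h\<in>carrier R. e \<sqsubseteq>\<^bsub>idem_alg R\<^esub> bval R (sharp_form \<phi>) [g, h]"
      using gh by blast
  next
    assume "\<exists>g\<in>carrier R. \<exists>h\<in>carrier R. e \<sqsubseteq>\<^bsub>idem_alg R\<^esub> bval R (sharp_form \<phi>) [g, h]"
    then obtain g h where gh: "g \<in> carrier R" "h \<in> carrier R"
      and le: "e \<sqsubseteq>\<^bsub>idem_alg R\<^esub> bval R (sharp_form \<phi>) [g, h]"
      by blast
    have exn: "bval_exists R (Neg \<phi>) [h]"
      using gh assms(1) by (intro ex) auto
    \<comment> \<open>Comparing atom by atom: wherever the sharp formula holds,
      \<open>\<phi>(h)\<close> fails. The value of \<open>\<not>\<phi>(h)\<close> is in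
      \<open>Fin\<close> by axiom (5), and an ideal is closed downwards.\<close>
    have "e \<sqsubseteq>\<^bsub>idem_alg R\<^esub> bval R (Neg \<phi>) [h]"
      using le le_bval_iff[OF at exs[OF gh] e] le_bval_iff[OF at exn e]
        sat_sharp_formD[OF assms(1)] by fastforce
    then show "e \<in> Fin"
      using id neg[OF gh(2)] e unfolding bideal_def by blast
  qed
  have sub: "Fin \<subseteq> carrier (idem_alg R)" "carrier (idem_alg R) \<subseteq> carrier R"
    using id by (auto simp: bideal_def idem_alg_def)
  \<comment> \<open>The formula itself asserts that \<open>x\<close> is idempotent, so the
    equivalence extends from idempotents to all of \<open>R\<close>.\<close>
  have "sat R [x] (below_bval_form (sharp_form \<phi>)) \<longleftrightarrow> x \<in> Fin" if "x \<in> carrier R" for x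
    using sat_below_bval_form[OF at fvf_sharp_form[OF assms(1)] exs that] main[of x] sub(1) by auto
  then have "Fin = {x \<in> carrier R. sat R [x] (below_bval_form (sharp_form \<phi>))}"
    using sub by auto
  then have "definable R Fin"
    unfolding definable_def
    by (intro exI[of _ "below_bval_form (sharp_form \<phi>)"] conjI fvf_below_bval_form
        fvf_sharp_form assms(1))
  then show ?thesis
    using main by blast
qed

end
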